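(* Let $(\mathfrak s=\mathfrak a\oplus\mathfrak n,\langle\cdot,\cdot\rangle)$ be a solvable pseudo-Riemannian metric Lie algebra of strong Iwasawa type, let $(S,g)$ be the associated simply connected solvmanifold, and let $(S',g')$ be the attached submanifold defined by $\Lambda'$, with attached metric subalgebra $(\mathfrak s',\langle\cdot,\cdot\rangle')$. Then $(S',g')$ is a minimal submanifold of $(S,g)$; that is, the trace of the second fundamental form $h$ of $\mathfrak s'$ in $\mathfrak s$ is zero.
   Context: All Lie algebras are real and finite-dimensional. A (pseudo-Riemannian) metric Lie algebra is a Lie algebra with a nondegenerate symmetric bilinear form (scalar product) $\langle\cdot,\cdot\rangle$. An orthonormal basis $\{E_i\}$ consists of pairwise orthogonal vectors with $\epsilon_i:=\langle E_i,E_i\rangle\in\{-1,1\}$. Strong Iwasawa type: a solvable metric Lie algebra $(\mathfrak s,\langle\cdot,\cdot\rangle)$ such that (1) $\mathfrak s=\mathfrak a\oplus\mathfrak n$ where $\mathfrak n=[\mathfrak s,\mathfrak s]$ and $\mathfrak a$ is the orthogonal complement of $\mathfrak n$ and is abelian; (2) for every $A\in\mathfrak a$, $\mathrm{ad}_A$ is symmetric with respect to $\langle\cdot,\cdot\rangle$, and $\mathrm{ad}_A=0$ iff $A=0$; (3) there is $A^0\in\mathfrak a$ such that $\mathrm{ad}_{A^0}|_{\mathfrak n}$ has all eigenvalues positive; (4) $\langle\cdot,\cdot\rangle$ is positive definite on $\mathfrak a$. Roots: for $\alpha\in\mathfrak a^*$, $\mathfrak n_\alpha=\{X\in\mathfrak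 n: [A,X]=\alpha(A)X\ \forall A\in\mathfrak a\}$; $\alpha$ is a root if $\mathfrak n_\alpha\ne0$, and $\Delta$ is the set of roots. It is assumed that $\mathfrak n=\bigoplus_{\alpha\in\Delta}\mathfrak n_\alpha$ (an orthogonal direct sum, with $\langle\cdot,\cdot\rangle$ nondegenerate on each $\mathfrak n_\alpha$). $\mathfrak a^*$ carries the scalar product dual to that of $\mathfrak a$. For a root $\beta$, $\check s_\beta:\mathfrak a^*\to\mathfrak a^*$ is the reflection $\check s_\beta(\alpha)=\alpha-\frac{2\langle\alpha,\beta\rangle}{\langle\beta,\beta\rangle}\beta$. Attached subalgebra: let $\Lambda=\{\alpha_i\}\subseteq\Delta$ be a finite set that is a basis of $\mathfrak a^*$ and such that every root is a linear combination of elements of $\Lambda$ with coefficients in $\mathbb Z_{\ge0}$. Let $\{B_{\alpha_i}\}$ be the dual basis of $\mathfrak a$: $\alpha_i(B_{\alpha_j})=\delta_{ij}$. Let $\Lambda'\subsetneq\Lambda$ and $Z=\sum_{\alpha\in\Lambda\setminus\Lambda'}B_\alpha$. Assume that for every $\alpha_j\in\Lambda'$, $\check s_{\alpha_j}$ permutes the set of roots $\alpha$ with $\alpha(Z)>0$, and $\dim\mathfrak n_\alpha=\dim\mathfrak n_{\check s_{\alpha_j}(\alpha)}$ for each such $\alpha$. The attached subalgebra defined by $\Lambda'$ is $\mathfrak s'=\mathfrak a'\oplus\mathfrak n'$ with $\mathfrak a'=\mathrm{span}\{B_\alpha:\alpha\in\Lambda\setminus\Lambda'\}$, $\mathfrak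 n'=\bigoplus_{\alpha\in\Delta,\,\alpha(Z)>0}\mathfrak n_\alpha$, with the restricted scalar product $\langle\cdot,\cdot\rangle'$. The solvmanifold $(S,g)$ is the simply connected Lie group with Lie algebra $\mathfrak s$ and the left-invariant metric determined by $\langle\cdot,\cdot\rangle$; the attached submanifold $(S',g')$ is the one defined by $(\mathfrak s',\langle\cdot,\cdot\rangle')$, i.e. the connected subgroup with Lie algebra $\mathfrak s'$ and the induced metric. Second fundamental form: for a metric Lie algebra $\mathfrak g$, $U:\mathfrak g\times\mathfrak g\to\mathfrak g$ is the symmetric bilinear map $\langle U(X,Y),W\rangle=\frac12(\langle[W,X],Y\rangle+\langle[W,Y],X\rangle)$ for all $W\in\mathfrak g$. With $U$ for $\mathfrak s$ and $U'$ for $(\mathfrak s',\langle\cdot,\cdot\rangle')$, the second fundamental form of $\mathfrak s'$ in $\mathfrak s$ is $h(X,Y)=U(X,Y)-U'(X,Y)$, $X,Y\in\mathfrak s'$. Its trace is $\sum_i\epsilon_i h(E_i,E_i)$ over an orthonormal basis of $\mathfrak s'$; $\mathfrak s'$ (and the submanifold) is minimal if this trace is zero. *)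

theory Defs
  imports "HOL-Analysis.Analysis" "HOL-Library.Function_Algebras"
begin

text \<open>
  Linear functionals are functions \<open>'a \<Rightarrow> real\<close>, so the pointwise vector space structure on functions
  makes \<^const>\<open>span\<close> and \<^const>\<open>independent\<close> available for sets of functionals.
\<close>

instantiation "fun" :: (type, real_vector) real_vector
begin

definition scaleR_fun :: "real \<Rightarrow> ('a \<Rightarrow> 'b) \<Rightarrow> 'a \<Rightarrow> 'b"
  where "scaleR_fun c f = (\<lambda>x. c *\<^sub>R f x)"

instance
  by standard (auto simp: scaleR_fun_def fun_eq_iff scaleR_add_right scaleR_add_left)

end


text \<open>
  Throughout, the Lie algebra \<open>s\<close> is the whole type \<open>'a\<close> with bracket \<open>br\<close>, and \<open>g\<close> is its scalar
  product. No topology or norm on \<open>'a\<close> is involved.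
\<close>

definition lie_algebra :: "('a::real_vector \<Rightarrow> 'a \<Rightarrow> 'a) \<Rightarrow> bool"
  where "lie_algebra br \<longleftrightarrow>
    (\<exists>S. finite S \<and> span S = (UNIV :: 'a set)) \<and>
    bilinear br \<and>
    (\<forall>X. br X X = 0) \<and>
    (\<forall>X Y Z. br X (br Y Z) + br Y (br Z X) + br Z (br X Y) = 0)"

definition nondegenerate_on :: "('a::real_vector \<Rightarrow> 'a \<Rightarrow> real) \<Rightarrow> 'a set \<Rightarrow> bool"
  where "nondegenerate_on g V \<longleftrightarrow> (\<forall>X\<in>V. (\<forall>Y\<in>V. g X Y = 0) \<longrightarrow> X = 0)"

definition scalar_product :: "('a::real_vector \<Rightarrow> 'a \<Rightarrow> real) \<Rightarrow> bool"
  where "scalar_product g \<longleftrightarrow>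
    bilinear g \<and> (\<forall>X Y. g X Y = g Y X) \<and> nondegenerate_on g UNIV"

definition metric_lie_algebra ::
    "('a::real_vector \<Rightarrow> 'a \<Rightarrow> 'a) \<Rightarrow> ('a \<Rightarrow> 'a \<Rightarrow> real) \<Rightarrow> bool"
  where "metric_lie_algebra br g \<longleftrightarrow> lie_algebra br \<and> scalar_product g"

definition bracket_span ::
    "('a::real_vector \<Rightarrow> 'a \<Rightarrow> 'a) \<Rightarrow> 'a set \<Rightarrow> 'a set \<Rightarrow> 'a set"
  where "bracket_span br V W = span {br X Y | X Y. X \<in> V \<and> Y \<in> W}"

primrec derived_series :: "('a::real_vector \<Rightarrow> 'a \<Rightarrow> 'a) \<Rightarrow> nat \<Rightarrow> 'a set"
  where
    "derived_series br 0 = UNIV"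
  | "derived_series br (Suc k) = bracket_span br (derived_series br k) (derived_series br k)"

definition solvable_lie_algebra :: "('a::real_vector \<Rightarrow> 'a \<Rightarrow> 'a) \<Rightarrow> bool"
  where "solvable_lie_algebra br \<longleftrightarrow> lie_algebra br \<and> (\<exists>k. derived_series br k = {0})"


definition nn :: "('a::real_vector \<Rightarrow> 'a \<Rightarrow> 'a) \<Rightarrow> 'a set"
  where "nn br = bracket_span br UNIV UNIV"

definition aa :: "('a::real_vector \<Rightarrow> 'a \<Rightarrow> 'a) \<Rightarrow> ('a \<Rightarrow> 'a \<Rightarrow> real) \<Rightarrow> 'a set"
  where "aa br g = {X. \<forall>Y\<in>nn br. g X Y = 0}"

text \<open>
  Eigenvalues of the restriction of \<open>T\<close> to an invariant subspace \<open>V\<close> are complex: \<open>X + i Y\<close> is an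
  eigenvector of the complexification. (Symmetric operators for an indefinite scalar product may have
  nonreal eigenvalues.)
\<close>

definition complex_eigenvalue_on :: "('a::real_vector \<Rightarrow> 'a) \<Rightarrow> 'a set \<Rightarrow> complex \<Rightarrow> bool"
  where "complex_eigenvalue_on T V z \<longleftrightarrow>
    (\<exists>X\<in>V. \<exists>Y\<in>V. (X \<noteq> 0 \<or> Y \<noteq> 0) \<and>
      T X = Re z *\<^sub>R X - Im z *\<^sub>R Y \<and>
      T Y = Im z *\<^sub>R X + Re z *\<^sub>R Y)"

definition strong_iwasawa_type ::
    "('a::real_vector \<Rightarrow> 'a \<Rightarrow> 'a) \<Rightarrow> ('a \<Rightarrow> 'a \<Rightarrow> real) \<Rightarrow> bool"
  where "strong_iwasawa_type br g \<longleftrightarrow>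
    metric_lie_algebra br g \<and>
    solvable_lie_algebra br \<and>
    aa br g \<inter> nn br = {0} \<and>
    (\<forall>X. \<exists>A\<in>aa br g. \<exists>N\<in>nn br. X = A + N) \<and>
    (\<forall>A\<in>aa br g. \<forall>B\<in>aa br g. br A B = 0) \<and>
    (\<forall>A\<in>aa br g. \<forall>X Y. g (br A X) Y = g X (br A Y)) \<and>
    (\<forall>A\<in>aa br g. (\<forall>X. br A X = 0) \<longleftrightarrow> A = 0) \<and>
    (\<exists>A0\<in>aa br g. \<forall>z. complex_eigenvalue_on (br A0) (nn br) z \<longrightarrow> Im z = 0 \<and> Re z > 0) \<and>
    (\<forall>A\<in>aa br g. A \<noteq> 0 \<longrightarrow> g A A > 0)"


text \<open>
  An element of \<open>a\<^sup>*\<close> is represented by the unique function that agrees with it on the subspace \<open>a\<close>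
  and is 0 off \<open>a\<close>; equality of functionals on \<open>a\<close> is then equality of functions.
\<close>

definition dual_space :: "'a::real_vector set \<Rightarrow> ('a \<Rightarrow> real) set"
  where "dual_space V =
    {\<alpha>. (\<forall>x\<in>V. \<forall>y\<in>V. \<alpha> (x + y) = \<alpha> x + \<alpha> y) \<and>
        (\<forall>c. \<forall>x\<in>V. \<alpha> (c *\<^sub>R x) = c * \<alpha> x) \<and>
        (\<forall>x. x \<notin> V \<longrightarrow> \<alpha> x = 0)}"

definition metric_dual ::
    "('a::real_vector \<Rightarrow> 'a \<Rightarrow> real) \<Rightarrow> 'a set \<Rightarrow> ('a \<Rightarrow> real) \<Rightarrow> 'a"
  where "metric_dual g V \<alpha> = (THE H. H \<in> V \<and> (\<forall>X\<in>V. g H X = \<alpha> X))"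

definition dual_product ::
    "('a::real_vector \<Rightarrow> 'a \<Rightarrow> real) \<Rightarrow> 'a set \<Rightarrow> ('a \<Rightarrow> real) \<Rightarrow> ('a \<Rightarrow> real) \<Rightarrow> real"
  where "dual_product g V \<alpha> \<beta> = g (metric_dual g V \<alpha>) (metric_dual g V \<beta>)"

definition root_space ::
    "('a::real_vector \<Rightarrow> 'a \<Rightarrow> 'a) \<Rightarrow> ('a \<Rightarrow> 'a \<Rightarrow> real) \<Rightarrow> ('a \<Rightarrow> real) \<Rightarrow> 'a set"
  where "root_space br g \<alpha> = {X \<in> nn br. \<forall>A\<in>aa br g. br A X = \<alpha> A *\<^sub>R X}"

definition roots ::
    "('a::real_vector \<Rightarrow> 'a \<Rightarrow> 'a) \<Rightarrow> ('a \<Rightarrow> 'a \<Rightarrow> real) \<Rightarrow> ('a \<Rightarrow> real) set"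
  where "roots br g = {\<alpha> \<in> dual_space (aa br g). root_space br g \<alpha> \<noteq> {0}}"

definition root_space_decomposition ::
    "('a::real_vector \<Rightarrow> 'a \<Rightarrow> 'a) \<Rightarrow> ('a \<Rightarrow> 'a \<Rightarrow> real) \<Rightarrow> bool"
  where "root_space_decomposition br g \<longleftrightarrow>
    span (\<Union>\<alpha>\<in>roots br g. root_space br g \<alpha>) = nn br \<and>
    (\<forall>\<alpha>\<in>roots br g.
       root_space br g \<alpha> \<inter> span (\<Union>\<beta>\<in>roots br g - {\<alpha>}. root_space br g \<beta>) = {0}) \<and>
    (\<forall>\<alpha>\<in>roots br g. \<forall>\<beta>\<in>roots br g. \<alpha> \<noteq> \<beta> \<longrightarrow>
       (\<forall>X\<in>root_space br g \<alpha>. \<forall>Y\<in>root_space br g \<beta>. g X Y = 0)) \<and>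
    (\<forall>\<alpha>\<in>roots br g. nondegenerate_on g (root_space br g \<alpha>))"

definition root_reflection ::
    "('a::real_vector \<Rightarrow> 'a \<Rightarrow> 'a) \<Rightarrow> ('a \<Rightarrow> 'a \<Rightarrow> real) \<Rightarrow>
     ('a \<Rightarrow> real) \<Rightarrow> ('a \<Rightarrow> real) \<Rightarrow> ('a \<Rightarrow> real)"
  where "root_reflection br g \<beta> \<alpha> =
    \<alpha> - (2 * dual_product g (aa br g) \<alpha> \<beta> / dual_product g (aa br g) \<beta> \<beta>) *\<^sub>R \<beta>"


definition simple_root_basis ::
    "('a::real_vector \<Rightarrow> 'a \<Rightarrow> 'a) \<Rightarrow> ('a \<Rightarrow> 'a \<Rightarrow> real) \<Rightarrow> ('a \<Rightarrow> real) set \<Rightarrow> bool"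
  where "simple_root_basis br g \<Lambda> \<longleftrightarrow>
    finite \<Lambda> \<and> \<Lambda> \<subseteq> roots br g \<and>
    independent \<Lambda> \<and> span \<Lambda> = dual_space (aa br g) \<and>
    (\<forall>\<alpha>\<in>roots br g. \<exists>c :: ('a \<Rightarrow> real) \<Rightarrow> nat. \<alpha> = (\<Sum>\<beta>\<in>\<Lambda>. real (c \<beta>) *\<^sub>R \<beta>))"

definition dual_basis_of ::
    "'a::real_vector set \<Rightarrow> ('a \<Rightarrow> real) set \<Rightarrow> (('a \<Rightarrow> real) \<Rightarrow> 'a) \<Rightarrow> bool"
  where "dual_basis_of V \<Lambda> B \<longleftrightarrow>
    (\<forall>\<beta>\<in>\<Lambda>. B \<beta> \<in> V) \<and>
    (\<forall>\<alpha>\<in>\<Lambda>. \<forall>\<beta>\<in>\<Lambda>. \<alpha> (B \<beta>) = (if \<alpha> = \<beta> then 1 else 0))"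

definition grading_vector ::
    "('a \<Rightarrow> real) set \<Rightarrow> ('a \<Rightarrow> real) set \<Rightarrow> (('a \<Rightarrow> real) \<Rightarrow> 'a::real_vector) \<Rightarrow> 'a"
  where "grading_vector \<Lambda> \<Lambda>' B = (\<Sum>\<alpha>\<in>\<Lambda> - \<Lambda>'. B \<alpha>)"

definition positive_roots ::
    "('a::real_vector \<Rightarrow> 'a \<Rightarrow> 'a) \<Rightarrow> ('a \<Rightarrow> 'a \<Rightarrow> real) \<Rightarrow> 'a \<Rightarrow> ('a \<Rightarrow> real) set"
  where "positive_roots br g Z = {\<alpha> \<in> roots br g. \<alpha> Z > 0}"

definition reflections_permute ::
    "('a::real_vector \<Rightarrow> 'a \<Rightarrow> 'a) \<Rightarrow> ('a \<Rightarrow> 'a \<Rightarrow> real) \<Rightarrow> ('a \<Rightarrow> real) set \<Rightarrow> 'a \<Rightarrow> bool"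
  where "reflections_permute br g \<Lambda>' Z \<longleftrightarrow>
    (\<forall>\<beta>\<in>\<Lambda>'.
       bij_betw (root_reflection br g \<beta>) (positive_roots br g Z) (positive_roots br g Z) \<and>
       (\<forall>\<alpha>\<in>positive_roots br g Z.
          dim (root_space br g \<alpha>) = dim (root_space br g (root_reflection br g \<beta> \<alpha>))))"

definition attached_subalgebra ::
    "('a::real_vector \<Rightarrow> 'a \<Rightarrow> 'a) \<Rightarrow> ('a \<Rightarrow> 'a \<Rightarrow> real) \<Rightarrow>
     ('a \<Rightarrow> real) set \<Rightarrow> ('a \<Rightarrow> real) set \<Rightarrow> (('a \<Rightarrow> real) \<Rightarrow> 'a) \<Rightarrow> 'a set"
  where "attached_subalgebra br g \<Lambda> \<Lambda>' B =
    {A + N | A N. A \<in> span (B ` (\<Lambda> - \<Lambda>')) \<and>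
       N \<in> span (\<Union>\<alpha>\<in>positive_roots br g (grading_vector \<Lambda> \<Lambda>' B). root_space br g \<alpha>)}"


text \<open>
  The map \<open>U\<close> of the metric Lie subalgebra \<open>V\<close> (with restricted bracket and scalar product); it is
  determined by its defining equation when \<open>g\<close> is nondegenerate on \<open>V\<close>.
\<close>

definition U_map ::
    "('a::real_vector \<Rightarrow> 'a \<Rightarrow> 'a) \<Rightarrow> ('a \<Rightarrow> 'a \<Rightarrow> real) \<Rightarrow> 'a set \<Rightarrow> 'a \<Rightarrow> 'a \<Rightarrow> 'a"
  where "U_map br g V X Y =
    (THE u. u \<in> V \<and> (\<forall>W\<in>V. g u W = 1/2 * (g (br W X) Y + g (br W Y) X)))"

definition second_fundamental_form ::
    "('a::real_vector \<Rightarrow> 'a \<Rightarrow> 'a) \<Rightarrow> ('a \<Rightarrow> 'a \<Rightarrow> real) \<Rightarrow> 'a set \<Rightarrow> 'a \<Rightarrow> 'a \<Rightarrow> 'a"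
  where "second_fundamental_form br g V X Y = U_map br g UNIV X Y - U_map br g V X Y"

definition orthonormal_basis_of ::
    "('a::real_vector \<Rightarrow> 'a \<Rightarrow> real) \<Rightarrow> 'a set \<Rightarrow> 'a set \<Rightarrow> bool"
  where "orthonormal_basis_of g V E \<longleftrightarrow>
    finite E \<and> independent E \<and> span E = V \<and>
    (\<forall>X\<in>E. \<forall>Y\<in>E. X \<noteq> Y \<longrightarrow> g X Y = 0) \<and>
    (\<forall>X\<in>E. g X X \<in> {-1, 1})"

definition trace_along ::
    "('a::real_vector \<Rightarrow> 'a \<Rightarrow> real) \<Rightarrow> 'a set \<Rightarrow> ('a \<Rightarrow> 'a \<Rightarrow> 'a) \<Rightarrow> 'a"
  where "trace_along g E h = (\<Sum>X\<in>E. g X X *\<^sub>R h X X)"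

text \<open>
  The trace does not depend on the orthonormal basis; the first conjunct makes sure that the
  condition on the trace is not vacuous.
\<close>

definition minimal_subalgebra ::
    "('a::real_vector \<Rightarrow> 'a \<Rightarrow> 'a) \<Rightarrow> ('a \<Rightarrow> 'a \<Rightarrow> real) \<Rightarrow> 'a set \<Rightarrow> bool"
  where "minimal_subalgebra br g V \<longleftrightarrow>
    (\<exists>E. orthonormal_basis_of g V E) \<and>
    (\<forall>E. orthonormal_basis_of g V E \<longrightarrow> trace_along g E (second_fundamental_form br g V) = 0)"

end

theory Submission
  imports Defs
begin

text \<open>
  Let \<open>H\<close> be the trace of \<open>U\<close> over an orthonormal basis of \<open>s'\<close>, so that \<open>\<langle>H, W\<rangle>\<close> is the trace of
  \<open>\<langle>[W, \<cdot>], \<cdot>\<rangle>\<close> over \<open>s'\<close>. Computed in a basis adapted to the root spaces, this trace vanishes for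
  \<open>W \<in> n\<close>, and for \<open>W \<in> a\<close> it equals \<open>\<tau>(W)\<close> with \<open>\<tau> = \<Sum> dim n\<^sub>\<alpha> \<cdot> \<alpha>\<close>, summed over the roots with
  \<open>\<alpha>(Z) > 0\<close>. Hence \<open>H\<close> lies in \<open>a\<close> and is dual to \<open>\<tau>\<close>. For \<open>\<beta> \<in> \<Lambda>'\<close> the reflection in \<open>\<beta>\<close> permutes the
  summands of \<open>\<langle>\<tau>, \<beta>\<rangle>\<close> and changes the sign of each, so \<open>\<beta>(H) = 0\<close>. Therefore \<open>H \<in> a' \<subseteq> s'\<close>, and since
  the trace of \<open>U'\<close> has the same products with \<open>s'\<close>, it equals \<open>H\<close>.
\<close>

section \<open>Orthonormal bases for indefinite forms\<close>

text \<open>The orthogonality part of \<open>orthonormal_basis_of\<close> on its own: independence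
  follows from it, so orthonormal subsets can be enlarged before anything is known about their
  span.\<close>

definition orthonormal_set :: "('a::real_vector \<Rightarrow> 'a \<Rightarrow> real) \<Rightarrow> 'a set \<Rightarrow> bool"
  where "orthonormal_set g E \<longleftrightarrow>
    (\<forall>X\<in>E. \<forall>Y\<in>E. X \<noteq> Y \<longrightarrow> g X Y = 0) \<and> (\<forall>X\<in>E. g X X \<in> {-1, 1})"

lemma orthonormal_basis_of_iff:
  "orthonormal_basis_of g V E \<longleftrightarrow> finite E \<and> independent E \<and> span E = V \<and> orthonormal_set g E"
  by (simp add: orthonormal_basis_of_def orthonormal_set_def)

locale symmetric_form =
  fixes g :: "'a::real_vector \<Rightarrow> 'a \<Rightarrow> real"
  assumes bilinear: "bilinear g"
    and sym: "g X Y = g Y X"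
begin

lemmas form_simps =
  bilinear_ladd[OF bilinear] bilinear_radd[OF bilinear]
  bilinear_lmul[OF bilinear] bilinear_rmul[OF bilinear]
  bilinear_lsub[OF bilinear] bilinear_rsub[OF bilinear]
  bilinear_lzero[OF bilinear] bilinear_rzero[OF bilinear]

lemma form_sum_left: "g (sum f A) Y = (\<Sum>x\<in>A. g (f x) Y)"
  using bilinear by (simp add: bilinear_def linear_sum[of "\<lambda>X. g X Y"])

lemma form_sum_right: "g Y (sum f A) = (\<Sum>x\<in>A. g Y (f x))"
  using bilinear by (simp add: bilinear_def linear_sum[of "g Y"])

lemma orthogonal_span:
  assumes "\<And>X. X \<in> E \<Longrightarrow> g Y X = 0" "X \<in> span E"
  shows "g Y X = 0"
  using assms(2) by (induction rule: span_induct) (auto simp: subspace_def form_simps assms(1))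

lemma orthonormal_sum:
  assumes "finite E" "orthonormal_set g E" "Y \<in> E"
  shows "g (\<Sum>X\<in>E. c X *\<^sub>R X) Y = c Y * g Y Y"
proof -
  have "g (\<Sum>X\<in>E. c X *\<^sub>R X) Y = (\<Sum>X\<in>E. if X = Y then c X * g X X else 0)"
    unfolding form_sum_left
    by (rule sum.cong) (use assms in \<open>auto simp: form_simps orthonormal_set_def\<close>)
  then show ?thesis using assms by simp
qed

lemma orthonormal_set_square:
  assumes "orthonormal_set g E" "X \<in> E"
  shows "g X X * g X X = 1"
  using assms by (auto simp: orthonormal_set_def)

text \<open>Pairing a vanishing combination with one of its vectors \<open>v\<close> leaves
  \<open>u v * g v v\<close>, and \<open>g v v\<close> is a unit even for an indefinite
  form.\<close>

lemma orthonormal_set_independent: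
  assumes "orthonormal_set g E"
  shows "independent E"
  unfolding independent_explicit_module
proof (intro allI impI)
  fix t u v
  assume t: "finite t" "t \<subseteq> E" "(\<Sum>v\<in>t. u v *\<^sub>R v) = 0" "v \<in> t"
  have on: "orthonormal_set g t"
    using assms t(2) by (auto simp: orthonormal_set_def)
  have "u v * g v v = 0"
    using orthonormal_sum[OF t(1) on t(4), of u] t(3) by (simp add: form_simps)
  then show "u v = 0"
    using orthonormal_set_square[OF on t(4)] by auto
qed

text \<open>Usual Fourier coefficients would be \<open>g X Y / g Y Y\<close>; since
  \<open>g Y Y\<close> is 1 or -1, it is its own inverse and appears as a factor.\<close>

lemma orthonormal_expansion:
  assumes "finite E" "orthonormal_set g E" "X \<in> span E"
  shows "X = (\<Sum>Y\<in>E. (g Y Y * g X Y) *\<^sub>R Y)"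
  using assms(3)
proof (induction rule: span_induct)
  case base
  show ?case
  proof (rule subspaceI)
    fix c X assume "X \<in> {X. X = (\<Sum>Y\<in>E. (g Y Y * g X Y) *\<^sub>R Y)}"
    then have X: "(\<Sum>Y\<in>E. (g Y Y * g X Y) *\<^sub>R Y) = X" by simp
    have "(\<Sum>Y\<in>E. (g Y Y * g (c *\<^sub>R X) Y) *\<^sub>R Y) = c *\<^sub>R (\<Sum>Y\<in>E. (g Y Y * g X Y) *\<^sub>R Y)"
      by (simp add: scaleR_sum_right form_simps mult.left_commute)
    then show "c *\<^sub>R X \<in> {X. X = (\<Sum>Y\<in>E. (g Y Y * g X Y) *\<^sub>R Y)}"
      unfolding X by simp
  qed (auto simp: form_simps algebra_simps sum.distrib)
next
  case (step X)
  have "(\<Sum>Y\<in>E. (g Y Y * g X Y) *\<^sub>R Y) = (\<Sum>Y\<in>E. if Y = X then X else 0)"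
    by (rule sum.cong) (use assms step orthonormal_set_square[OF assms(2)] in
      \<open>auto simp: orthonormal_set_def\<close>)
  then show ?case using assms step by simp
qed

lemma normalize:
  assumes "g w w \<noteq> 0"
  obtains c where "c \<noteq> 0" "g (c *\<^sub>R w) (c *\<^sub>R w) \<in> {-1, 1}"
proof
  let ?c = "1 / sqrt \<bar>g w w\<bar>"
  show "?c \<noteq> 0" using assms by simp
  have "?c * ?c = 1 / \<bar>g w w\<bar>" by simp
  then show "g (?c *\<^sub>R w) (?c *\<^sub>R w) \<in> {-1, 1}"
    using assms by (auto simp: form_simps mult.assoc[symmetric] abs_if)
qed

text \<open>Gram-Schmidt may get stuck at null vectors, so an orthonormal subset \<open>E\<close> of
  \<open>V\<close> of maximal cardinality is taken; independence bounds the cardinality by that of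
  \<open>S\<close>. Maximality makes every vector of its orthogonal complement \<open>C\<close> in
  \<open>V\<close> null, hence \<open>C\<close> is totally isotropic, and nondegeneracy on
  \<open>V\<close> then forces \<open>C = {0}\<close>.\<close>

lemma exists_orthonormal_basis:
  assumes V: "subspace V" and nondeg: "nondegenerate_on g V"
    and S: "finite S" "V \<subseteq> span S"
  shows "\<exists>E. orthonormal_basis_of g V E"
proof -
  let ?P = "\<lambda>E. E \<subseteq> V \<and> orthonormal_set g E"
  have bound: "finite E \<and> card E \<le> card S" if "?P E" for E
    using that S independent_span_bound[of S E] orthonormal_set_independent by blast
  have "?P {}" by (simp add: orthonormal_set_def)
  moreover have "\<forall>E. ?P E \<longrightarrow> card E < Suc (card S)"
    using bound by (simp add: less_Suc_eq_le)
  ultimately obtain E where E: "?P E" and max: "\<And>F. ?P F \<Longrightarrow> card F \<le> card E"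
    using ex_has_greatest_nat[of ?P "{}" card "Suc (card S)"] by blast
  have fin: "finite E" using bound E by blast
  define C where "C = {w \<in> V. \<forall>X\<in>E. g w X = 0}"
  have null: "g w w = 0" if w: "w \<in> C" for w
  proof (rule ccontr)
    assume "g w w \<noteq> 0"
    then obtain c where c: "c \<noteq> 0" "g (c *\<^sub>R w) (c *\<^sub>R w) \<in> {-1, 1}"
      by (rule normalize)
    have "?P (insert (c *\<^sub>R w) E)"
      using E w c V sym by (auto simp: orthonormal_set_def C_def form_simps subspace_scale)
    moreover have "c *\<^sub>R w \<notin> E"
      using w c by (auto simp: C_def form_simps)
    ultimately show False using max[of "insert (c *\<^sub>R w) E"] fin by simp
  qed
  \<comment> \<open>Polarization: expanding \<open>g (w + w') (w + w') = 0\<close> leaves twice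
    \<open>g w w'\<close>.\<close>
  have isotropic: "g w w' = 0" if "w \<in> C" "w' \<in> C" for w w'
  proof -
    have "w + w' \<in> C" using that V by (auto simp: C_def form_simps subspace_add)
    then show ?thesis
      using null[of "w + w'"] null[of w] null[of w'] that sym[of w w'] by (simp add: form_simps)
  qed
  have proj: "v - (\<Sum>Y\<in>E. (g Y Y * g v Y) *\<^sub>R Y) \<in> C" if v: "v \<in> V" for v
  proof -
    have "(\<Sum>Y\<in>E. (g Y Y * g v Y) *\<^sub>R Y) \<in> V"
      using E V by (auto intro!: subspace_sum subspace_scale)
    then show ?thesis
      using v V E fin orthonormal_set_square[of E]
      by (auto simp: C_def subspace_diff form_simps orthonormal_sum)
  qed
  have "C = {0}"
  proof -
    \<comment> \<open>Each \<open>v\<close> in \<open>V\<close> is a combination of \<open>E\<close>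
      plus an element of \<open>C\<close>, and \<open>w\<close> is orthogonal to both
      summands.\<close>
    have "w = 0" if w: "w \<in> C" for w
    proof -
      have "g w v = 0" if v: "v \<in> V" for v
      proof -
        have "g w (\<Sum>Y\<in>E. (g Y Y * g v Y) *\<^sub>R Y) = 0"
          using w by (auto simp: form_sum_right form_simps C_def)
        then show ?thesis
          using isotropic[OF w proj[OF v]] by (simp add: form_simps)
      qed
      then show ?thesis using nondeg w by (auto simp: nondegenerate_on_def C_def)
    qed
    moreover have "0 \<in> C" using V by (auto simp: C_def subspace_0 form_simps)
    ultimately show ?thesis by blast
  qed
  have "V \<subseteq> span E"
  proof
    fix v assume "v \<in> V"
    then have "v = (\<Sum>Y\<in>E. (g Y Y * g v Y) *\<^sub>R Y)"
      using proj \<open>C = {0}\<close> by force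
    also have "\<dots> \<in> span E" by (intro span_sum span_scale span_base)
    finally show "v \<in> span E" .
  qed
  moreover have "span E \<subseteq> V" using E V by (simp add: span_minimal)
  ultimately show ?thesis
    using E fin orthonormal_set_independent by (auto simp: orthonormal_basis_of_iff)
qed

lemma orthonormal_basis_unique:
  assumes "orthonormal_basis_of g V E" "u \<in> V" "v \<in> V" "\<And>W. W \<in> V \<Longrightarrow> g u W = g v W"
  shows "u = v"
proof -
  have E: "finite E" "orthonormal_set g E" "span E = V"
    using assms(1) by (auto simp: orthonormal_basis_of_iff)
  have "E \<subseteq> V" using E(3) span_base by blast
  have "u = (\<Sum>Y\<in>E. (g Y Y * g u Y) *\<^sub>R Y)"
    using orthonormal_expansion[OF E(1,2)] assms E by blast
  also have "\<dots> = (\<Sum>Y\<in>E. (g Y Y * g v Y) *\<^sub>R Y)"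
    using assms(4) \<open>E \<subseteq> V\<close> by (intro sum.cong) auto
  also have "\<dots> = v"
    using orthonormal_expansion[OF E(1,2), of v] assms E by simp
  finally show ?thesis .
qed

text \<open>The representing vector has coefficients \<open>g X X * f X\<close> in an orthonormal
  basis. Linearity of \<open>f\<close> is asked for on \<open>V\<close> only, so that elements of
  \<open>dual_space\<close> qualify, which are cut off to 0 outside.\<close>

lemma riesz:
  assumes E: "orthonormal_basis_of g V E"
    and add: "\<And>x y. x \<in> V \<Longrightarrow> y \<in> V \<Longrightarrow> f (x + y) = f x + f y"
    and scale: "\<And>c x. x \<in> V \<Longrightarrow> f (c *\<^sub>R x) = c * f x"
  shows "\<exists>!u. u \<in> V \<and> (\<forall>W\<in>V. g u W = f W)"
proof -
  have *: "finite E" "orthonormal_set g E" "span E = V"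
    using E by (auto simp: orthonormal_basis_of_iff)
  have V: "subspace V" using * subspace_span by blast
  define u where "u = (\<Sum>X\<in>E. (g X X * f X) *\<^sub>R X)"
  have "u \<in> V"
    unfolding u_def *(3)[symmetric] by (intro span_sum span_scale span_base)
  moreover have "g u W = f W" if W: "W \<in> V" for W
  proof -
    have "f 0 = 0" using scale[of 0 0] V by (simp add: subspace_0)
    have "W \<in> span E" using W * by simp
    \<comment> \<open>Membership in \<open>V\<close> is carried through the induction because
      additivity of \<open>f\<close> is available only there.\<close>
    then have "W \<in> V \<and> g u W = f W"
    proof (induction rule: span_induct)
      case base
      show ?case
        using V add scale \<open>f 0 = 0\<close> unfolding subspace_def by (auto simp: form_simps)
    next
      case (step X)
      then have "g u X = g X X * f X * g X X"
        unfolding u_def using orthonormal_sum[OF *(1,2) step] by simp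
      then show ?case
        using orthonormal_set_square[OF *(2) step] * step span_base
        by (auto simp: mult.commute mult.left_commute)
    qed
    then show ?thesis ..
  qed
  ultimately show ?thesis
    using orthonormal_basis_unique[OF E] by (auto intro!: ex1I[of _ u])
qed

text \<open>Expand the first argument of \<open>b X X\<close> in \<open>F\<close>, exchange the
  sums, and recognize the expansion of \<open>Y\<close> in \<open>E\<close> in the second argument.
  No symmetry of \<open>b\<close> enters, so the lemma applies to the form
  \<open>\<langle>[W, X], Y\<rangle>\<close>.\<close>

lemma trace_basis_independent:
  assumes E: "orthonormal_basis_of g V E" and F: "orthonormal_basis_of g V F"
    and b: "bilinear b"
  shows "(\<Sum>X\<in>E. g X X * b X X) = (\<Sum>Y\<in>F. g Y Y * b Y Y :: real)"
proof -
  have E': "finite E" "orthonormal_set g E" "span E = V"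
    using E by (auto simp: orthonormal_basis_of_iff)
  have F': "finite F" "orthonormal_set g F" "span F = V"
    using F by (auto simp: orthonormal_basis_of_iff)
  have l: "linear (\<lambda>X. b X Y)" and r: "linear (b Y)" for Y
    using b by (auto simp: bilinear_def)
  have "(\<Sum>X\<in>E. g X X * b X X) = (\<Sum>X\<in>E. \<Sum>Y\<in>F. g X X * (g Y Y * g X Y * b Y X))"
  proof (rule sum.cong)
    fix X assume "X \<in> E"
    then have "X = (\<Sum>Y\<in>F. (g Y Y * g X Y) *\<^sub>R Y)"
      using orthonormal_expansion[OF F'(1,2)] E' F' span_base by blast
    then have "b X X = b (\<Sum>Y\<in>F. (g Y Y * g X Y) *\<^sub>R Y) X"
      by (rule arg_cong[where f = "\<lambda>Z. b Z X"])
    also have "\<dots> = (\<Sum>Y\<in>F. g Y Y * g X Y * b Y X)"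
      by (simp add: linear_sum[OF l] bilinear_lmul[OF b])
    finally show "g X X * b X X = (\<Sum>Y\<in>F. g X X * (g Y Y * g X Y * b Y X))"
      by (simp add: sum_distrib_left)
  qed simp
  also have "\<dots> = (\<Sum>Y\<in>F. \<Sum>X\<in>E. g X X * (g Y Y * g X Y * b Y X))"
    by (rule sum.swap)
  also have "\<dots> = (\<Sum>Y\<in>F. g Y Y * b Y Y)"
  proof (rule sum.cong)
    fix Y assume "Y \<in> F"
    then have "Y = (\<Sum>X\<in>E. (g X X * g Y X) *\<^sub>R X)"
      using orthonormal_expansion[OF E'(1,2)] E' F' span_base by blast
    then have "b Y Y = b Y (\<Sum>X\<in>E. (g X X * g Y X) *\<^sub>R X)"
      by (rule arg_cong[where f = "b Y"])
    also have "\<dots> = (\<Sum>X\<in>E. g X X * g Y X * b Y X)"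
      by (simp add: linear_sum[OF r] bilinear_rmul[OF b])
    finally show "(\<Sum>X\<in>E. g X X * (g Y Y * g X Y * b Y X)) = g Y Y * b Y Y"
      by (simp add: sum_distrib_left sym mult.commute mult.left_commute)
  qed simp
  finally show ?thesis .
qed

text \<open>The defining condition is linear in \<open>W\<close>, so \<open>riesz\<close> gives the
  unique vector that the description operator needs.\<close>

lemma U_map_char:
  assumes E: "orthonormal_basis_of g V E" and br: "bilinear br"
  shows "U_map br g V X Y \<in> V"
    and "W \<in> V \<Longrightarrow> g (U_map br g V X Y) W = 1/2 * (g (br W X) Y + g (br W Y) X)"
proof -
  have "\<exists>!u. u \<in> V \<and> (\<forall>W\<in>V. g u W = 1/2 * (g (br W X) Y + g (br W Y) X))"
    by (rule riesz[OF E])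
      (simp_all add: form_simps bilinear_ladd[OF br] bilinear_lmul[OF br] algebra_simps)
  from theI'[OF this] show "U_map br g V X Y \<in> V"
    and "W \<in> V \<Longrightarrow> g (U_map br g V X Y) W = 1/2 * (g (br W X) Y + g (br W Y) X)"
    unfolding U_map_def by blast+
qed

end

section \<open>Root spaces\<close>

locale iwasawa = symmetric_form g
  for br :: "'a::real_vector \<Rightarrow> 'a \<Rightarrow> 'a" and g :: "'a \<Rightarrow> 'a \<Rightarrow> real" +
  assumes strong_iwasawa: "strong_iwasawa_type br g"
    and decomposition: "root_space_decomposition br g"
begin

abbreviation "\<aa> \<equiv> aa br g"
abbreviation "\<nn> \<equiv> nn br"
abbreviation "\<Delta> \<equiv> roots br g"
abbreviation "R \<equiv> root_space br g"

lemma bilinear_br: "bilinear br"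
  using strong_iwasawa by (simp add: strong_iwasawa_type_def metric_lie_algebra_def lie_algebra_def)

lemmas br_simps =
  bilinear_ladd[OF bilinear_br] bilinear_radd[OF bilinear_br]
  bilinear_lmul[OF bilinear_br] bilinear_rmul[OF bilinear_br]
  bilinear_lneg[OF bilinear_br] bilinear_rneg[OF bilinear_br]
  bilinear_lzero[OF bilinear_br] bilinear_rzero[OF bilinear_br]

lemma br_self: "br X X = 0"
  using strong_iwasawa by (simp add: strong_iwasawa_type_def metric_lie_algebra_def lie_algebra_def)

lemma br_antisym: "br X Y = - br Y X"
  using br_self[of "X + Y"] br_self[of X] br_self[of Y]
  by (simp add: br_simps eq_neg_iff_add_eq_0 add.commute)

lemma jacobi: "br X (br Y Z) + br Y (br Z X) + br Z (br X Y) = 0"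
  using strong_iwasawa by (simp add: strong_iwasawa_type_def metric_lie_algebra_def lie_algebra_def)

lemma finite_spanning: "\<exists>S. finite S \<and> span S = (UNIV :: 'a set)"
  using strong_iwasawa by (simp add: strong_iwasawa_type_def metric_lie_algebra_def lie_algebra_def)

lemma nondegenerate: "nondegenerate_on g UNIV"
  using strong_iwasawa by (simp add: strong_iwasawa_type_def metric_lie_algebra_def scalar_product_def)

lemma ad_symmetric: "A \<in> \<aa> \<Longrightarrow> g (br A X) Y = g X (br A Y)"
  using strong_iwasawa by (simp add: strong_iwasawa_type_def)

lemma aa_abelian: "A \<in> \<aa> \<Longrightarrow> A' \<in> \<aa> \<Longrightarrow> br A A' = 0"
  using strong_iwasawa by (simp add: strong_iwasawa_type_def)

lemma aa_positive: "A \<in> \<aa> \<Longrightarrow> A \<noteq> 0 \<Longrightarrow> g A A > 0"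
  using strong_iwasawa by (simp add: strong_iwasawa_type_def)

lemma aa_nn_orthogonal: "A \<in> \<aa> \<Longrightarrow> N \<in> \<nn> \<Longrightarrow> g A N = 0"
  by (simp add: aa_def)

lemma subspace_aa: "subspace \<aa>"
  by (auto simp: subspace_def aa_def form_simps)

lemma subspace_nn: "subspace \<nn>"
  by (simp add: nn_def bracket_span_def)

lemma subspace_root_space: "subspace (R \<alpha>)"
  using subspace_nn by (auto simp: subspace_def root_space_def br_simps scaleR_add_right)

lemma nn_span: "\<nn> = span (\<Union>\<alpha>\<in>\<Delta>. R \<alpha>)"
  using decomposition by (simp add: root_space_decomposition_def)

lemma root_space_nn: "X \<in> R \<alpha> \<Longrightarrow> X \<in> \<nn>"
  by (simp add: root_space_def)

lemma ad_root_space: "A \<in> \<aa> \<Longrightarrow> X \<in> R \<alpha> \<Longrightarrow> br A X = \<alpha> A *\<^sub>R X"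
  by (simp add: root_space_def)

lemma root_spaces_orthogonal:
  "\<alpha> \<in> \<Delta> \<Longrightarrow> \<beta> \<in> \<Delta> \<Longrightarrow> \<alpha> \<noteq> \<beta> \<Longrightarrow> X \<in> R \<alpha> \<Longrightarrow> Y \<in> R \<beta> \<Longrightarrow> g X Y = 0"
  using decomposition unfolding root_space_decomposition_def by blast

lemma root_dual: "\<alpha> \<in> \<Delta> \<Longrightarrow> \<alpha> \<in> dual_space \<aa>"
  by (simp add: roots_def)

text \<open>A nonzero root vector, taken with imaginary part 0, is an eigenvector of the
  complexified operator with eigenvalue \<alpha>(A0). One element thus serves all roots; in
  particular no root is zero.\<close>

lemma roots_positive_element: "\<exists>A0\<in>\<aa>. \<forall>\<alpha>\<in>\<Delta>. \<alpha> A0 > 0"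
proof -
  have "\<exists>A0\<in>\<aa>. \<forall>z. complex_eigenvalue_on (br A0) \<nn> z \<longrightarrow> Im z = 0 \<and> Re z > 0"
    using strong_iwasawa by (simp add: strong_iwasawa_type_def)
  then obtain A0 where A0: "A0 \<in> \<aa>"
    "\<And>z. complex_eigenvalue_on (br A0) \<nn> z \<Longrightarrow> Im z = 0 \<and> Re z > 0"
    by blast
  have "\<alpha> A0 > 0" if \<alpha>: "\<alpha> \<in> \<Delta>" for \<alpha>
  proof -
    obtain X where X: "X \<in> R \<alpha>" "X \<noteq> 0"
      using \<alpha> subspace_0[OF subspace_root_space] unfolding roots_def by blast
    have "complex_eigenvalue_on (br A0) \<nn> (complex_of_real (\<alpha> A0))"
      unfolding complex_eigenvalue_on_def
      using X A0(1) subspace_0[OF subspace_nn]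
      by (rule_tac bexI[of _ X], rule_tac bexI[of _ 0]) (auto simp: ad_root_space root_space_nn br_simps)
    from A0(2)[OF this] show ?thesis by simp
  qed
  then show ?thesis using A0(1) by blast
qed

section \<open>Orthonormal bases adapted to the root spaces\<close>

lemma orthonormal_basis_subspace:
  assumes "subspace V" "nondegenerate_on g V"
  shows "\<exists>E. orthonormal_basis_of g V E"
proof -
  obtain S where "finite S" "span S = (UNIV :: 'a set)" using finite_spanning by blast
  then show ?thesis using exists_orthonormal_basis[OF assms, of S] by simp
qed

lemma orthonormal_basis_UNIV: "\<exists>E. orthonormal_basis_of g UNIV E"
  by (rule orthonormal_basis_subspace[OF subspace_UNIV nondegenerate])

lemma orthonormal_basis_aa:
  assumes "subspace V" "V \<subseteq> \<aa>"
  shows "\<exists>E. orthonormal_basis_of g V E"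
  by (rule orthonormal_basis_subspace[OF assms(1)])
    (use assms(2) aa_positive in \<open>force simp: nondegenerate_on_def\<close>)

lemma orthonormal_basis_root_space:
  "\<alpha> \<in> \<Delta> \<Longrightarrow> \<exists>E. orthonormal_basis_of g (R \<alpha>) E"
  using decomposition
  by (intro orthonormal_basis_subspace subspace_root_space)
    (auto simp: root_space_decomposition_def)

text \<open>Root spaces are orthogonal to each other and to \<open>\<aa>\<close>, so the union of
  the bases is orthonormal. A vector shared by two of them would be null, which gives disjointness.
  The last three claims allow a sum over the union to be split into sums over the pieces.\<close>

lemma adapted_basis:
  assumes P: "P \<subseteq> \<Delta>" and F: "\<And>\<alpha>. \<alpha> \<in> P \<Longrightarrow> orthonormal_basis_of g (R \<alpha>) (F \<alpha>)"
    and V: "V \<subseteq> \<aa>" and Fa: "orthonormal_basis_of g V Fa"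
  shows "orthonormal_basis_of g {A + N | A N. A \<in> V \<and> N \<in> span (\<Union>\<alpha>\<in>P. R \<alpha>)} (Fa \<union> (\<Union>\<alpha>\<in>P. F \<alpha>))"
    and "disjoint_family_on F P" and "Fa \<inter> (\<Union>\<alpha>\<in>P. F \<alpha>) = {}"
    and "finite P"
proof -
  have F': "finite (F \<alpha>)" "span (F \<alpha>) = R \<alpha>" "orthonormal_set g (F \<alpha>)" if "\<alpha> \<in> P" for \<alpha>
    using F[OF that] by (auto simp: orthonormal_basis_of_iff)
  have Fa': "finite Fa" "span Fa = V" "orthonormal_set g Fa"
    using Fa by (auto simp: orthonormal_basis_of_iff)
  have FR: "X \<in> R \<alpha>" if "\<alpha> \<in> P" "X \<in> F \<alpha>" for X \<alpha>
    using F'(2)[OF that(1)] that(2) span_base by blast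
  have FaV: "X \<in> \<aa>" if "X \<in> Fa" for X
    using Fa' V span_base that by blast
  have Fn: "X \<noteq> 0" if "\<alpha> \<in> P" "X \<in> F \<alpha>" for X \<alpha>
    using F'(3)[OF that(1)] that(2) by (auto simp: orthonormal_set_def form_simps)
  have on: "orthonormal_set g (Fa \<union> (\<Union>\<alpha>\<in>P. F \<alpha>))"
  proof -
    have "g X Y = 0" if "X \<noteq> Y" "X \<in> F \<alpha>" "Y \<in> F \<beta>" "\<alpha> \<in> P" "\<beta> \<in> P" for X Y \<alpha> \<beta>
      using that FR P root_spaces_orthogonal[of \<alpha> \<beta> X Y] F'(3)
      by (cases "\<alpha> = \<beta>") (auto simp: orthonormal_set_def)
    moreover have "g X Y = 0 \<and> g Y X = 0" if "X \<in> Fa" "Y \<in> F \<beta>" "\<beta> \<in> P" for X Y \<beta>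
      using that FR FaV sym aa_nn_orthogonal root_space_nn by metis
    moreover have "g X Y = 0" if "X \<noteq> Y" "X \<in> Fa" "Y \<in> Fa" for X Y
      using that Fa'(3) by (simp add: orthonormal_set_def)
    ultimately have "\<forall>X\<in>Fa \<union> (\<Union>\<alpha>\<in>P. F \<alpha>). \<forall>Y\<in>Fa \<union> (\<Union>\<alpha>\<in>P. F \<alpha>). X \<noteq> Y \<longrightarrow> g X Y = 0"
      by blast
    then show ?thesis
      using F'(3) Fa'(3) unfolding orthonormal_set_def by fast
  qed
  show disj: "disjoint_family_on F P"
    unfolding disjoint_family_on_def
  proof (intro ballI impI, rule ccontr)
    fix \<alpha> \<beta> assume a: "\<alpha> \<in> P" "\<beta> \<in> P" "\<alpha> \<noteq> \<beta>" "F \<alpha> \<inter> F \<beta> \<noteq> {}"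
    then obtain X where X: "X \<in> F \<alpha>" "X \<in> F \<beta>" by blast
    then have "g X X = 0" using root_spaces_orthogonal a P FR by blast
    then show False using F'(3)[OF a(1)] X by (auto simp: orthonormal_set_def)
  qed
  show disj': "Fa \<inter> (\<Union>\<alpha>\<in>P. F \<alpha>) = {}"
    using FaV FR Fa'(3) aa_nn_orthogonal root_space_nn
    by (fastforce simp: orthonormal_set_def)
  let ?F = "Fa \<union> (\<Union>\<alpha>\<in>P. F \<alpha>)"
  have ind: "independent ?F" by (rule orthonormal_set_independent[OF on])
  have fin: "finite ?F"
  proof -
    obtain S where "finite S" "span S = (UNIV :: 'a set)" using finite_spanning by blast
    then show ?thesis using independent_span_bound[OF _ ind, of S] by simp
  qed
  have ne: "F \<alpha> \<noteq> {}" if "\<alpha> \<in> P" for \<alpha>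
    using F'(2)[OF that] that P by (auto simp: roots_def)
  \<comment> \<open>Choosing one vector from each \<open>F \<alpha>\<close> embeds \<open>P\<close>
    into the basis, which is finite as an independent set in a finite-dimensional space.\<close>
  show finP: "finite P"
  proof (rule inj_on_finite)
    show "inj_on (\<lambda>\<alpha>. SOME X. X \<in> F \<alpha>) P"
    proof (rule inj_onI, rule ccontr)
      fix \<alpha> \<beta> assume a: "\<alpha> \<in> P" "\<beta> \<in> P" "(SOME X. X \<in> F \<alpha>) = (SOME X. X \<in> F \<beta>)" "\<alpha> \<noteq> \<beta>"
      have "(SOME X. X \<in> F \<alpha>) \<in> F \<alpha>" "(SOME X. X \<in> F \<beta>) \<in> F \<beta>"
        using ne[OF a(1)] ne[OF a(2)] some_in_eq by metis+
      then show False using disj a by (auto simp: disjoint_family_on_def)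
    qed
    show "(\<lambda>\<alpha>. SOME X. X \<in> F \<alpha>) ` P \<subseteq> ?F"
      using ne some_in_eq by fastforce
  qed (fact fin)
  have "span (\<Union>\<alpha>\<in>P. F \<alpha>) = span (\<Union>\<alpha>\<in>P. R \<alpha>)"
  proof
    show "span (\<Union>\<alpha>\<in>P. F \<alpha>) \<subseteq> span (\<Union>\<alpha>\<in>P. R \<alpha>)"
      using FR by (intro span_mono) blast
    have "R \<alpha> \<subseteq> span (\<Union>\<alpha>\<in>P. F \<alpha>)" if "\<alpha> \<in> P" for \<alpha>
      unfolding F'(2)[OF that, symmetric] using that by (intro span_mono) blast
    then show "span (\<Union>\<alpha>\<in>P. R \<alpha>) \<subseteq> span (\<Union>\<alpha>\<in>P. F \<alpha>)"
      by (intro span_minimal subspace_span) blast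
  qed
  then have "span ?F = {A + N | A N. A \<in> V \<and> N \<in> span (\<Union>\<alpha>\<in>P. R \<alpha>)}"
    unfolding span_Un Fa'(2) by blast
  then show "orthonormal_basis_of g {A + N | A N. A \<in> V \<and> N \<in> span (\<Union>\<alpha>\<in>P. R \<alpha>)} ?F"
    using ind fin on by (simp add: orthonormal_basis_of_iff)
qed

text \<open>Symmetry of \<open>ad\<^sub>A\<close> gives \<open>(\<alpha> + \<gamma>)(A) \<langle>[W, X], X\<rangle> = \<alpha>(A) \<langle>[W, X], X\<rangle>\<close>, and \<open>\<gamma>(A) \<noteq> 0\<close> for some \<open>A\<close>.\<close>

lemma root_bracket_orthogonal:
  assumes W: "W \<in> R \<gamma>" "\<gamma> \<in> \<Delta>" and X: "X \<in> R \<alpha>"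
  shows "g (br W X) X = 0"
proof -
  obtain A where A: "A \<in> \<aa>" "\<gamma> A > 0" using roots_positive_element W(2) by blast
  have "br A (br W X) = - br W (br X A) - br X (br A W)"
    using jacobi[of A W X] by (simp add: algebra_simps eq_neg_iff_add_eq_0)
  also have "br X A = - \<alpha> A *\<^sub>R X"
    using br_antisym[of X A] ad_root_space[OF A(1) X] by simp
  also have "br A W = \<gamma> A *\<^sub>R W" by (rule ad_root_space[OF A(1) W(1)])
  finally have "br A (br W X) = (\<alpha> A + \<gamma> A) *\<^sub>R br W X"
    by (simp add: br_simps br_antisym[of X W] algebra_simps)
  moreover have "g (br A (br W X)) X = \<alpha> A * g (br W X) X"
    using ad_symmetric[OF A(1)] ad_root_space[OF A(1) X] by (simp add: form_simps)
  ultimately show ?thesis using A(2) by (simp add: form_simps algebra_simps)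
qed

text \<open>The bracket is a multiple of \<open>W\<close> itself, which lies in \<open>\<nn>\<close>
  and is therefore orthogonal to \<open>X\<close>.\<close>

lemma root_bracket_aa_orthogonal:
  assumes W: "W \<in> R \<gamma>" and X: "X \<in> \<aa>"
  shows "g (br W X) X = 0"
  using br_antisym[of W X] ad_root_space[OF X W] aa_nn_orthogonal[OF X root_space_nn[OF W]] sym[of W X]
  by (metis bilinear_lmul[OF bilinear] bilinear_lneg[OF bilinear] scaleR_zero_right neg_0_equal_iff_equal)

section \<open>Duality on \<open>\<aa>\<close> and root reflections\<close>

lemma metric_dual_aa:
  assumes "\<alpha> \<in> dual_space \<aa>"
  shows "metric_dual g \<aa> \<alpha> \<in> \<aa>"
    and "X \<in> \<aa> \<Longrightarrow> g (metric_dual g \<aa> \<alpha>) X = \<alpha> X"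
proof -
  obtain E where E: "orthonormal_basis_of g \<aa> E"
    using orthonormal_basis_aa[OF subspace_aa] by blast
  have "\<exists>!u. u \<in> \<aa> \<and> (\<forall>W\<in>\<aa>. g u W = \<alpha> W)"
    by (rule riesz[OF E]) (use assms in \<open>auto simp: dual_space_def\<close>)
  from theI'[OF this] show "metric_dual g \<aa> \<alpha> \<in> \<aa>" "X \<in> \<aa> \<Longrightarrow> g (metric_dual g \<aa> \<alpha>) X = \<alpha> X"
    unfolding metric_dual_def by blast+
qed

text \<open>Evaluation at the metric dual of \<beta> is the scalar product with \<beta>, and the
  reflection negates that product. The division is legitimate because \<beta> is nonzero and
  \<open>g\<close> is positive definite on \<open>\<aa>\<close>.\<close>

lemma root_reflection_dual:
  assumes "\<alpha> \<in> \<Delta>" "\<beta> \<in> \<Delta>"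
  shows "root_reflection br g \<beta> \<alpha> (metric_dual g \<aa> \<beta>) = - \<alpha> (metric_dual g \<aa> \<beta>)"
proof -
  let ?H = "metric_dual g \<aa> \<beta>"
  obtain A where A: "A \<in> \<aa>" "\<beta> A > 0" using roots_positive_element assms(2) by blast
  note \<alpha> = metric_dual_aa[OF root_dual[OF assms(1)]]
    and \<beta> = metric_dual_aa[OF root_dual[OF assms(2)]]
  have "?H \<noteq> 0" using \<beta>(2)[OF A(1)] A(2) by (auto simp: form_simps)
  then have "\<beta> ?H > 0" using aa_positive[OF \<beta>(1)] \<beta> by simp
  moreover have "dual_product g \<aa> \<alpha> \<beta> = \<alpha> ?H" "dual_product g \<aa> \<beta> \<beta> = \<beta> ?H"
    using \<alpha> \<beta> by (simp_all add: dual_product_def)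
  ultimately show ?thesis
    by (simp add: root_reflection_def scaleR_fun_def)
qed

text \<open>Reindexing by the reflection turns the sum into its own negative. The weight
  \<open>m\<close> will be the dimension of the root space.\<close>

lemma weighted_root_sum_vanishes:
  assumes \<beta>: "\<beta> \<in> \<Delta>" and P: "P \<subseteq> \<Delta>"
    and bij: "bij_betw (root_reflection br g \<beta>) P P"
    and m: "\<And>\<alpha>. \<alpha> \<in> P \<Longrightarrow> m \<alpha> = m (root_reflection br g \<beta> \<alpha>)"
  shows "(\<Sum>\<alpha>\<in>P. m \<alpha> * \<alpha> (metric_dual g \<aa> \<beta>)) = (0::real)"
proof -
  let ?H = "metric_dual g \<aa> \<beta>" and ?s = "root_reflection br g \<beta>"
  have "(\<Sum>\<alpha>\<in>P. m \<alpha> * \<alpha> ?H) = (\<Sum>\<alpha>\<in>P. m (?s \<alpha>) * ?s \<alpha> ?H)"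
    by (rule sum.reindex_bij_betw[OF bij, symmetric])
  also have "\<dots> = (\<Sum>\<alpha>\<in>P. - (m \<alpha> * \<alpha> ?H))"
    using P \<beta> by (intro sum.cong) (auto simp: root_reflection_dual m[symmetric])
  finally show ?thesis by (simp add: sum_negf)
qed

text \<open>The difference of the two sides is annihilated by \<Lambda>, hence by its span, the
  whole dual space. This contains the pairing with the difference itself, so positive definiteness
  makes it 0.\<close>

lemma dual_basis_expansion:
  assumes \<Lambda>: "simple_root_basis br g \<Lambda>" and B: "dual_basis_of \<aa> \<Lambda> B" and H: "H \<in> \<aa>"
  shows "H = (\<Sum>\<beta>\<in>\<Lambda>. \<beta> H *\<^sub>R B \<beta>)"
proof -
  have fin: "finite \<Lambda>" and sp: "span \<Lambda> = dual_space \<aa>"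
    and dual: "\<And>\<beta>. \<beta> \<in> \<Lambda> \<Longrightarrow> \<beta> \<in> dual_space \<aa>"
    using \<Lambda> root_dual by (auto simp: simple_root_basis_def)
  define S where "S = (\<Sum>\<beta>\<in>\<Lambda>. \<beta> H *\<^sub>R B \<beta>)"
  have Baa: "B \<beta> \<in> \<aa>" if "\<beta> \<in> \<Lambda>" for \<beta> using B that by (simp add: dual_basis_of_def)
  have S: "S \<in> \<aa>"
    unfolding S_def using Baa by (intro subspace_sum subspace_scale subspace_aa) auto
  let ?v = "H - S"
  have v: "?v \<in> \<aa>" using H S subspace_aa by (intro subspace_diff)
  have zero: "\<alpha> ?v = 0" if \<alpha>: "\<alpha> \<in> \<Lambda>" for \<alpha>
  proof -
    note d = metric_dual_aa[OF dual[OF \<alpha>]]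
    \<comment> \<open>Passing to the metric dual lets the sum be pulled out by bilinearity of
      \<open>g\<close>, since \<alpha> itself is linear only on \<open>\<aa>\<close>.\<close>
    have "\<alpha> S = g (metric_dual g \<aa> \<alpha>) S" using d(2)[OF S] by simp
    also have "\<dots> = (\<Sum>\<beta>\<in>\<Lambda>. \<beta> H * \<alpha> (B \<beta>))"
      unfolding S_def form_sum_right using d Baa by (intro sum.cong) (auto simp: form_simps)
    also have "\<dots> = (\<Sum>\<beta>\<in>\<Lambda>. if \<beta> = \<alpha> then \<beta> H else 0)"
      using B \<alpha> by (intro sum.cong) (auto simp: dual_basis_of_def)
    also have "\<dots> = \<alpha> H" using fin \<alpha> by simp
    finally show ?thesis
      using d(2)[OF v] d(2)[OF S] d(2)[OF H] by (simp add: form_simps)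
  qed
  have all: "f ?v = 0" if "f \<in> span \<Lambda>" for f
    using that by (induction rule: span_induct) (auto simp: subspace_def scaleR_fun_def zero)
  \<comment> \<open>The cutoff by 0 outside \<open>\<aa>\<close> is what membership in
    \<open>dual_space\<close> requires.\<close>
  let ?f = "\<lambda>X. if X \<in> \<aa> then g ?v X else 0"
  have "?f \<in> dual_space \<aa>"
    using subspace_aa by (auto simp: dual_space_def form_simps subspace_add subspace_scale)
  then have "g ?v ?v = 0" using all sp v by fastforce
  then show ?thesis using aa_positive[OF v] unfolding S_def by fastforce
qed

section \<open>The trace of the second fundamental form\<close>

lemma attached_minimal:
  assumes \<Lambda>: "simple_root_basis br g \<Lambda>" and B: "dual_basis_of \<aa> \<Lambda> B"
    and sub: "\<Lambda>' \<subseteq> \<Lambda>"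
    and refl: "reflections_permute br g \<Lambda>' (grading_vector \<Lambda> \<Lambda>' B)"
  shows "minimal_subalgebra br g (attached_subalgebra br g \<Lambda> \<Lambda>' B)"
proof -
  define P where "P = positive_roots br g (grading_vector \<Lambda> \<Lambda>' B)"
  define a' where "a' = span (B ` (\<Lambda> - \<Lambda>'))"
  define s' where "s' = attached_subalgebra br g \<Lambda> \<Lambda>' B"
  have P: "P \<subseteq> \<Delta>" by (auto simp: P_def positive_roots_def)
  have a': "subspace a'" "a' \<subseteq> \<aa>"
    using B span_minimal[OF _ subspace_aa, of "B ` (\<Lambda> - \<Lambda>')"]
    by (auto simp: a'_def dual_basis_of_def)
  have s': "s' = {A + N | A N. A \<in> a' \<and> N \<in> span (\<Union>\<alpha>\<in>P. R \<alpha>)}"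
    by (simp add: s'_def attached_subalgebra_def a'_def P_def)
  have "\<forall>\<alpha>\<in>P. \<exists>E. orthonormal_basis_of g (R \<alpha>) E"
    using orthonormal_basis_root_space P by blast
  then obtain F where F: "\<And>\<alpha>. \<alpha> \<in> P \<Longrightarrow> orthonormal_basis_of g (R \<alpha>) (F \<alpha>)"
    by metis
  obtain Fa where Fa: "orthonormal_basis_of g a' Fa"
    using orthonormal_basis_aa[OF a'] by blast
  note adapted = adapted_basis[OF P F a'(2) Fa, folded s']
  have FR: "X \<in> R \<alpha>" if "\<alpha> \<in> P" "X \<in> F \<alpha>" for X \<alpha>
    using F[OF that(1)] that(2) span_base by (auto simp: orthonormal_basis_of_iff)
  have FaV: "X \<in> \<aa>" if "X \<in> Fa" for X
    using Fa a' that span_base by (auto simp: orthonormal_basis_of_iff)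
  have fin: "finite Fa" "finite (F \<alpha>)" if "\<alpha> \<in> P" for \<alpha>
    using Fa F[OF that] by (auto simp: orthonormal_basis_of_iff)
  obtain EU where EU: "orthonormal_basis_of g UNIV EU" using orthonormal_basis_UNIV by blast
  have "trace_along g E (second_fundamental_form br g s') = 0"
    if E: "orthonormal_basis_of g s' E" for E
  proof -
    define H where "H = (\<Sum>X\<in>E. g X X *\<^sub>R U_map br g UNIV X X)"
    define H' where "H' = (\<Sum>X\<in>E. g X X *\<^sub>R U_map br g s' X X)"
    \<comment> \<open>The two halves of the formula for \<open>U\<close> coincide on the diagonal,
      which cancels the factor 1/2.\<close>
    have gH: "g H W = (\<Sum>X\<in>E. g X X * g (br W X) X)" for W
      by (simp add: H_def form_sum_left form_simps U_map_char(2)[OF EU bilinear_br])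
    have gH': "g H' W = (\<Sum>X\<in>E. g X X * g (br W X) X)" if "W \<in> s'" for W
      using that by (simp add: H'_def form_sum_left form_simps U_map_char(2)[OF E bilinear_br])
    have bil: "bilinear (\<lambda>X Y. g (br W X) Y)" for W
      by (auto simp: bilinear_def form_simps br_simps intro!: linearI)
    \<comment> \<open>The basis \<open>E\<close> is arbitrary; basis independence of the trace
      replaces it by the adapted one.\<close>
    have gH_adapted: "g H W = (\<Sum>X\<in>Fa. g X X * g (br W X) X)
        + (\<Sum>\<alpha>\<in>P. \<Sum>X\<in>F \<alpha>. g X X * g (br W X) X)" for W
    proof -
      have "g H W = (\<Sum>X\<in>Fa \<union> (\<Union>\<alpha>\<in>P. F \<alpha>). g X X * g (br W X) X)"
        unfolding gH by (rule trace_basis_independent[OF E adapted(1) bil])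
      also have "\<dots> = (\<Sum>X\<in>Fa. g X X * g (br W X) X) + (\<Sum>X\<in>(\<Union>\<alpha>\<in>P. F \<alpha>). g X X * g (br W X) X)"
        by (rule sum.union_disjoint)
          (use adapted fin Fa in \<open>auto simp: orthonormal_basis_of_iff\<close>)
      also have "(\<Sum>X\<in>(\<Union>\<alpha>\<in>P. F \<alpha>). g X X * g (br W X) X)
          = (\<Sum>\<alpha>\<in>P. \<Sum>X\<in>F \<alpha>. g X X * g (br W X) X)"
        by (rule sum.UNION_disjoint)
          (use adapted fin in \<open>auto simp: disjoint_family_on_def\<close>)
      finally show ?thesis .
    qed
    have "g H W = 0" if W: "W \<in> R \<gamma>" "\<gamma> \<in> \<Delta>" for W \<gamma>
    proof -
      have "g (br W X) X = 0" if "\<alpha> \<in> P" "X \<in> F \<alpha>" for \<alpha> X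
        using root_bracket_orthogonal[OF W] FR[OF that] by blast
      then show ?thesis
        using FaV root_bracket_aa_orthogonal[OF W(1)] by (simp add: gH_adapted)
    qed
    then have "g H W = 0" if "W \<in> \<nn>" for W
      using orthogonal_span[of "\<Union>\<alpha>\<in>\<Delta>. R \<alpha>" H W] that nn_span by blast
    then have Haa: "H \<in> \<aa>" by (simp add: aa_def)
    \<comment> \<open>The summands from \<open>Fa\<close> vanish because \<open>\<aa>\<close> is
      abelian. On \<open>F \<alpha>\<close> each summand is \<alpha>(A) times the square of a unit,
      so they add up to \<alpha>(A) times the dimension of the root space.\<close>
    have H\<tau>: "g H A = (\<Sum>\<alpha>\<in>P. real (dim (R \<alpha>)) * \<alpha> A)" if A: "A \<in> \<aa>" for A
    proof -
      have "(\<Sum>X\<in>F \<alpha>. g X X * g (br A X) X) = real (dim (R \<alpha>)) * \<alpha> A" if \<alpha>: "\<alpha> \<in> P" for \<alpha>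
      proof -
        have on: "orthonormal_set g (F \<alpha>)" "independent (F \<alpha>)" "span (F \<alpha>) = R \<alpha>"
          using F[OF \<alpha>] by (auto simp: orthonormal_basis_of_iff)
        have "(\<Sum>X\<in>F \<alpha>. g X X * g (br A X) X) = (\<Sum>X\<in>F \<alpha>. \<alpha> A)"
          using orthonormal_set_square[OF on(1)]
          by (intro sum.cong)
            (auto simp: ad_root_space[OF A FR[OF \<alpha>]] form_simps mult.left_commute)
        moreover have "dim (R \<alpha>) = card (F \<alpha>)"
          using dim_span_eq_card_independent[OF on(2)] on(3) by simp
        ultimately show ?thesis by simp
      qed
      then show ?thesis
        using FaV by (simp add: gH_adapted aa_abelian[OF A] form_simps)
    qed
    have \<Lambda>'_vanishes: "\<beta> H = 0" if \<beta>: "\<beta> \<in> \<Lambda>'" for \<beta>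
    proof -
      have \<beta>\<Delta>: "\<beta> \<in> \<Delta>" using \<beta> sub \<Lambda> by (auto simp: simple_root_basis_def)
      note d = metric_dual_aa[OF root_dual[OF \<beta>\<Delta>]]
      have "\<beta> H = (\<Sum>\<alpha>\<in>P. real (dim (R \<alpha>)) * \<alpha> (metric_dual g \<aa> \<beta>))"
        using d(2)[OF Haa] H\<tau>[OF d(1)] sym by simp
      also have "\<dots> = 0"
        by (rule weighted_root_sum_vanishes[OF \<beta>\<Delta> P])
          (use refl \<beta> in \<open>auto simp: reflections_permute_def P_def\<close>)
      finally show ?thesis .
    qed
    \<comment> \<open>In the expansion of \<open>H\<close> in the dual basis, the coefficients
      belonging to \<Lambda>' are 0 and the remaining basis vectors span \<open>a'\<close>.\<close>
    have "\<beta> H *\<^sub>R B \<beta> \<in> a'" if "\<beta> \<in> \<Lambda>" for \<beta>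
    proof (cases "\<beta> \<in> \<Lambda>'")
      case True
      from \<Lambda>'_vanishes[OF this] show ?thesis using a'(1) by (simp add: subspace_0)
    next
      case False
      then show ?thesis using that unfolding a'_def by (intro span_scale span_base) blast
    qed
    then have "(\<Sum>\<beta>\<in>\<Lambda>. \<beta> H *\<^sub>R B \<beta>) \<in> a'"
      by (intro subspace_sum a'(1))
    then have "H \<in> a'" using dual_basis_expansion[OF \<Lambda> B Haa] by simp
    then have "H \<in> s'" unfolding s' using span_zero by force
    moreover have "H' \<in> s'"
    proof -
      have "subspace s'" using E subspace_span by (auto simp: orthonormal_basis_of_iff)
      then show ?thesis
        unfolding H'_def by (intro subspace_sum subspace_scale U_map_char(1)[OF E bilinear_br])
    qed
    \<comment> \<open>Both vectors lie in \<open>s'\<close> and have the same products with it.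
      Their difference is the trace in question.\<close>
    ultimately have "H = H'"
      using orthonormal_basis_unique[OF E] gH gH' by metis
    then show ?thesis
      by (simp add: trace_along_def second_fundamental_form_def scaleR_diff_right sum_subtractf
          H_def H'_def)
  qed
  then show ?thesis
    using adapted(1) unfolding minimal_subalgebra_def s'_def by blast
qed

end

theorem theorem4p7:
  fixes br :: "'a::real_vector \<Rightarrow> 'a \<Rightarrow> 'a"
    and g :: "'a \<Rightarrow> 'a \<Rightarrow> real"
    and \<Lambda> \<Lambda>' :: "('a \<Rightarrow> real) set"
    and B :: "('a \<Rightarrow> real) \<Rightarrow> 'a"
  assumes "strong_iwasawa_type br g"
    and "root_space_decomposition br g"
    and "simple_root_basis br g \<Lambda>"
    and "dual_basis_of (aa br g) \<Lambda> B"
    and "\<Lambda>' \<subset> \<Lambda>"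
    and "reflections_permute br g \<Lambda>' (grading_vector \<Lambda> \<Lambda>' B)"
  shows "minimal_subalgebra br g (attached_subalgebra br g \<Lambda> \<Lambda>' B)"
proof -
  interpret iwasawa br g
    using assms(1,2)
    by unfold_locales
      (auto simp: strong_iwasawa_type_def metric_lie_algebra_def scalar_product_def)
  show ?thesis
    using attached_minimal[OF assms(3,4) _ assms(6)] assms(5) by blast
qed

end
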